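(* Assume $( * )$. There exist a Boolean algebra $\mathcal A$ with $\mathrm{fin}\subseteq\mathcal A\subseteq P(\omega)$ and a finitely additive probability measure $\mu$ on $\mathcal A$ such that (a) the quotient algebra $\mathcal A/\mathrm{fin}$ is not $\sigma$-centred, and (b) $\mu$ is almost strictly positive.
   Context: $\mathrm{fin}$ denotes the family of finite subsets of $\omega$. A finitely additive measure $\mu$ on an algebra $\mathcal A$ with $\mathrm{fin}\subseteq\mathcal A\subseteq P(\omega)$ is almost strictly positive if for every $A\in\mathcal A$: $\mu(A)=0$ iff $A$ is finite. Let $\lambda$ be the standard product measure on $2^\omega$, $\mathcal E$ the ideal of sets $A\subseteq 2^\omega$ with $\lambda(\overline A)=0$, $\kappa_0=\mathrm{cov}(\mathcal E)$ (least size of a cover of $2^\omega$ by members of $\mathcal E$), $\mathrm{cof}[\kappa_0]^{\le\omega}$ the least size of a family of countable subsets of $\kappa_0$ cofinal (under inclusion) among all countable subsets of $\kappa_0$, and $\mathfrak b$ the bounding number. The hypothesis $( * )$ is: $\mathrm{cof}[\kappa_0]^{\le\omega}\le\mathfrak b$. *)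

theory Defs
  imports "HOL-Probability.Probability"
begin

definition cantor_measure :: "(nat \<Rightarrow> bool) measure" where
  "cantor_measure = PiM UNIV (\<lambda>_::nat. measure_pmf (pmf_of_set (UNIV :: bool set)))"

definition cantor_closure :: "(nat \<Rightarrow> bool) set \<Rightarrow> (nat \<Rightarrow> bool) set" where
  "cantor_closure A = {x. \<forall>n. \<exists>y\<in>A. \<forall>i<n. y i = x i}"

definition E_ideal :: "(nat \<Rightarrow> bool) set set" where
  "E_ideal = {A. cantor_closure A \<in> null_sets cantor_measure}"

definition E_cover :: "(nat \<Rightarrow> bool) set set \<Rightarrow> bool" where
  "E_cover C \<longleftrightarrow> C \<subseteq> E_ideal \<and> \<Union>C = UNIV"

definition min_E_cover :: "(nat \<Rightarrow> bool) set set \<Rightarrow> bool" where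
  "min_E_cover C \<longleftrightarrow> E_cover C \<and> (\<forall>C'. E_cover C' \<longrightarrow> (card_of C, card_of C') \<in> ordLeq)"

definition unbounded_family :: "(nat \<Rightarrow> nat) set \<Rightarrow> bool" where
  "unbounded_family B \<longleftrightarrow> \<not> (\<exists>g. \<forall>f\<in>B. \<forall>\<^sub>F n in sequentially. f n \<le> g n)"

definition min_unbounded_family :: "(nat \<Rightarrow> nat) set \<Rightarrow> bool" where
  "min_unbounded_family B \<longleftrightarrow> unbounded_family B \<and>
     (\<forall>B'. unbounded_family B' \<longrightarrow> (card_of B, card_of B') \<in> ordLeq)"

definition cofinal_countable_family :: "'a set \<Rightarrow> 'a set set \<Rightarrow> bool" where
  "cofinal_countable_family K D \<longleftrightarrow>
     (\<forall>Y\<in>D. Y \<subseteq> K \<and> countable Y) \<and> (\<forall>X. X \<subseteq> K \<and> countable X \<longrightarrow> (\<exists>Y\<in>D. X \<subseteq> Y))"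

text \<open>Hypothesis (*): cof [cov E]^{<=omega} <= b.  Using a minimum E-cover C as a set of
  size kappa_0 = cov(E) and a minimum unbounded family B as a set of size b.\<close>
definition hyp_star :: bool where
  "hyp_star \<longleftrightarrow> (\<exists>C B D. min_E_cover C \<and> min_unbounded_family B \<and>
      cofinal_countable_family C D \<and> (card_of D, card_of B) \<in> ordLeq)"

definition finitely_additive_prob :: "nat set set \<Rightarrow> (nat set \<Rightarrow> real) \<Rightarrow> bool" where
  "finitely_additive_prob \<A> \<mu> \<longleftrightarrow>
     (\<forall>A\<in>\<A>. 0 \<le> \<mu> A) \<and> \<mu> UNIV = 1 \<and>
     (\<forall>A\<in>\<A>. \<forall>B\<in>\<A>. A \<inter> B = {} \<longrightarrow> \<mu> (A \<union> B) = \<mu> A + \<mu> B)"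

definition almost_strictly_positive :: "nat set set \<Rightarrow> (nat set \<Rightarrow> real) \<Rightarrow> bool" where
  "almost_strictly_positive \<A> \<mu> \<longleftrightarrow> (\<forall>A\<in>\<A>. \<mu> A = 0 \<longleftrightarrow> finite A)"

text \<open>A family of elements of A/fin (given by representatives) is centred iff every finite
  subfamily has a nonzero meet in A/fin, i.e. the intersection is infinite.\<close>
definition centred_mod_fin :: "nat set set \<Rightarrow> bool" where
  "centred_mod_fin F \<longleftrightarrow> (\<forall>S. S \<subseteq> F \<and> finite S \<longrightarrow> infinite (\<Inter>S))"

text \<open>A/fin is sigma-centred iff its nonzero elements (classes of infinite A in the algebra)
  are a countable union of centred families.\<close>
definition quotient_sigma_centred :: "nat set set \<Rightarrow> bool" where
  "quotient_sigma_centred \<A> \<longleftrightarrow>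
     (\<exists>F :: nat \<Rightarrow> nat set set. (\<forall>n. F n \<subseteq> \<A> \<and> centred_mod_fin (F n)) \<and>
        {A\<in>\<A>. infinite A} \<subseteq> (\<Union>n. F n))"

end

theory Submission
  imports Defs
begin

unbundle cardinal_syntax

text \<open>
  Let \<open>D\<close> be a family of at most \<open>\<bb>\<close> countable sets of closed null sets such that every countable
  subset of \<open>2\<^sup>\<omega>\<close> is covered by some \<open>Y \<in> D\<close>. For each \<open>Y \<in> D\<close> take a closed set \<open>u\<^sub>Y\<close> of positive
  measure that misses \<open>\<Union>Y\<close>. The algebra generated by the clopen sets and the \<open>u\<^sub>Y\<close>, modulo null
  sets, carries a strictly positive measure, and it is not \<open>\<sigma>\<close>-centred: countably many centred
  families determine countably many points of \<open>2\<^sup>\<omega>\<close>, and some \<open>u\<^sub>Y\<close> avoids neighbourhoods of all of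
  them. It embeds into \<open>P(\<omega>)/fin\<close> by transfinite recursion along \<open>D\<close>. Fewer than \<open>\<bb>\<close> elements
  \<open>t\<close> have been treated when \<open>u\<^sub>Y\<close> is chosen as the intersection of a decreasing sequence of
  clopen sets \<open>c\<^sub>n\<close>; choosing it generically over them, \<open>t \<inter> u\<^sub>Y\<close> is null only if some
  \<open>t \<inter> c\<^sub>n\<close> is null. Then the set representing \<open>u\<^sub>Y\<close> only has to fill a gap between the
  sequence \<open>c\<^sub>n\<close> and fewer than \<open>\<bb>\<close> sets, which is possible by the definition of \<open>\<bb>\<close>.
\<close>

section \<open>Families smaller than the bounding number\<close>

lemma min_unbounded_family_dominate:
  assumes "min_unbounded_family B" "|X| <o |B|"
  shows "\<exists>g::nat \<Rightarrow> nat. \<forall>x\<in>X. \<forall>\<^sub>F n in sequentially. f x n \<le> g n"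
proof (rule ccontr)
  assume "\<not> ?thesis"
  then have "unbounded_family (f ` X)"
    by (auto simp: unbounded_family_def)
  then have "|B| \<le>o |f ` X|"
    using assms(1) by (auto simp: min_unbounded_family_def)
  then have "|B| \<le>o |X|"
    using card_of_image ordLeq_transitive by blast
  then show False
    using assms(2) not_ordLess_ordLeq by blast
qed

text \<open>Domination on \<omega> is transferred along a coding of \<open>'s\<close> by natural
  numbers. It is applied to finite sequences of natural numbers.\<close>

lemma min_unbounded_family_dominate_countable:
  fixes f :: "'x \<Rightarrow> 's::countable \<Rightarrow> nat"
  assumes "min_unbounded_family B" "|X| <o |B|"
  shows "\<exists>g::'s \<Rightarrow> nat. \<forall>x\<in>X. finite {s. g s < f x s}"
proof -
  obtain g :: "nat \<Rightarrow> nat"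
    where g: "\<forall>x\<in>X. \<forall>\<^sub>F n in sequentially. f x (from_nat n) \<le> g n"
    using min_unbounded_family_dominate[OF assms, of "\<lambda>x n. f x (from_nat n)"] by auto
  have "finite {s. g (to_nat s) < f x s}" if "x \<in> X" for x
  proof -
    obtain N where N: "\<forall>n\<ge>N. f x (from_nat n) \<le> g n"
      using g \<open>x \<in> X\<close> by (auto simp: eventually_sequentially)
    have "{s. g (to_nat s) < f x s} \<subseteq> from_nat ` {..<N}"
    proof
      fix s assume "s \<in> {s. g (to_nat s) < f x s}"
      then have "\<not> N \<le> to_nat s"
        using N by (metis from_nat_to_nat leD mem_Collect_eq)
      then show "s \<in> from_nat ` {..<N}"
        by (metis from_nat_to_nat image_eqI lessThan_iff not_le)
    qed
    then show ?thesis
      by (rule finite_subset) simp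
  qed
  then show ?thesis
    by (intro exI[of _ "\<lambda>s. g (to_nat s)"]) auto
qed

text \<open>A diagonal function dominates any countable family, so \<bb> is uncountable.\<close>

lemma countable_less_min_unbounded_family:
  assumes "min_unbounded_family B" "countable X"
  shows "|X| <o |B|"
proof (rule ccontr)
  assume "\<not> ?thesis"
  then have "|B| \<le>o |X|"
    using not_ordLess_iff_ordLeq[OF card_of_Well_order card_of_Well_order] by blast
  then obtain f where "inj_on f B" "f ` B \<subseteq> X"
    using card_of_ordLeq[of B X] by blast
  then have "countable B"
    using assms(2) countable_image_inj_on countable_subset by blast
  define e where "e = from_nat_into B"
  have "\<forall>\<^sub>F n in sequentially. f n \<le> Max ((\<lambda>i. e i n) ` {..n})" if "f \<in> B" for f
  proof -
    obtain i where "f = e i"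
      using \<open>f \<in> B\<close> \<open>countable B\<close> unfolding e_def by (metis from_nat_into_surj)
    then have "\<forall>n\<ge>i. f n \<le> Max ((\<lambda>i. e i n) ` {..n})"
      by (auto intro!: Max_ge)
    then show ?thesis
      by (auto simp: eventually_sequentially)
  qed
  then have "\<not> unbounded_family B"
    unfolding unbounded_family_def not_not
    by (intro exI[of _ "\<lambda>n. Max ((\<lambda>i. e i n) ` {..n})"]) blast
  then show False
    using assms(1) by (simp add: min_unbounded_family_def)
qed

text \<open>The set \<open>P\<close> of the proof is almost contained in every \<open>A n\<close>
  whatever \<open>g\<close> is, and it grows with \<open>g\<close>. Below \<bb>, a single
  \<open>g\<close> can dominate the demands of all \<open>a\<close> in \<open>X\<close>, which makes
  \<open>P\<close> large enough for the other two clauses.\<close>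

lemma pseudo_intersection_below_bounding:
  fixes A :: "nat \<Rightarrow> nat set"
  assumes B: "min_unbounded_family B" "|X| <o |B|" and dec: "decseq A"
  shows "\<exists>P. (\<forall>n. finite (P - A n)) \<and>
    (\<forall>a\<in>X. (\<forall>n. infinite (a \<inter> A n)) \<longrightarrow> infinite (a \<inter> P)) \<and>
    (\<forall>a\<in>X. (\<forall>n. finite (a - A n)) \<longrightarrow> finite (a - P))"
proof -
  \<comment> \<open>\<open>hit a n\<close> is a point of the trace of \<open>a\<close> on
    \<open>A n\<close> beyond \<open>n\<close>, and \<open>bd a n\<close> exceeds all of
    \<open>a - A n\<close>. Each is meaningful only under the corresponding assumption on
    \<open>a\<close>.\<close>
  define hit where "hit a n = (SOME k. n \<le> k \<and> k \<in> a \<inter> A n)" for a n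
  define bd where "bd a n = Suc (Max (insert 0 (a - A n)))" for a n
  obtain g1 where g1: "\<forall>a\<in>X. \<forall>\<^sub>F n in sequentially. max (Suc (hit a n)) (bd a n) \<le> g1 n"
    using min_unbounded_family_dominate[OF B, of "\<lambda>a n. max (Suc (hit a n)) (bd a n)"] by auto
  \<comment> \<open>With the running maximum, \<open>hit a n < g1 n \<le> g m\<close> holds for
    large \<open>n\<close> and all \<open>m \<ge> n\<close>. So a hit is tested only against earlier
    sets \<open>A m\<close>, which contain \<open>A n\<close>.\<close>
  define g where "g n = Max (g1 ` {..n})" for n
  have g1_le: "g1 m \<le> g n" if "m \<le> n" for m n
    using that by (auto simp: g_def intro!: Max_ge)
  define P where "P = {k. \<forall>n. g n \<le> k \<longrightarrow> k \<in> A n}"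
  have "finite (P - A n)" for n
    by (rule finite_subset[of _ "{..<g n}"]) (auto simp: P_def not_le)
  moreover have "infinite (a \<inter> P)" if a: "a \<in> X" "\<forall>n. infinite (a \<inter> A n)" for a
  proof -
    have hit: "n \<le> hit a n \<and> hit a n \<in> a \<inter> A n" for n
    proof -
      have "\<exists>k. n \<le> k \<and> k \<in> a \<inter> A n"
        using a(2) unfolding infinite_nat_iff_unbounded_le by blast
      then show ?thesis
        unfolding hit_def by (rule someI_ex)
    qed
    obtain N where N: "\<And>n. N \<le> n \<Longrightarrow> hit a n < g1 n"
      using bspec[OF g1 a(1)] by (auto simp: eventually_sequentially Suc_le_eq)
    have "hit a n \<in> P" if "N \<le> n" for n
    proof -
      have "m \<le> n" if "g m \<le> hit a n" for m
      proof (rule ccontr)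
        assume "\<not> m \<le> n"
        then have "g1 n \<le> g m"
          by (intro g1_le) simp
        then show False
          using N[OF \<open>N \<le> n\<close>] that by linarith
      qed
      then show ?thesis
        using hit[of n] dec by (auto simp: P_def dest: decseqD)
    qed
    then have "\<exists>k\<ge>m. k \<in> a \<inter> P" for m
      using hit[of "max m N"] by (intro exI[of _ "hit a (max m N)"]) auto
    then show ?thesis
      by (simp add: infinite_nat_iff_unbounded_le)
  qed
  moreover have "finite (a - P)" if a: "a \<in> X" "\<forall>n. finite (a - A n)" for a
  proof -
    obtain N where N: "\<And>n. N \<le> n \<Longrightarrow> bd a n \<le> g1 n"
      using bspec[OF g1 a(1)] by (auto simp: eventually_sequentially)
    \<comment> \<open>A point \<open>k\<close> outside \<open>P\<close> has a witness
      \<open>n\<close> with \<open>g n \<le> k < bd a n\<close>. From \<open>N\<close> on,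
      \<open>bd a n \<le> g n\<close>, hence \<open>n < N\<close>.\<close>
    have "a - P \<subseteq> (\<Union>n<N. a - A n)"
    proof
      fix k assume "k \<in> a - P"
      then obtain n where n: "g n \<le> k" "k \<in> a - A n"
        by (auto simp: P_def)
      then have "k < bd a n"
        using a(2) by (auto simp: bd_def less_Suc_eq_le intro!: Max_ge)
      then have "\<not> N \<le> n"
        using N[of n] n(1) g1_le[of n n] by linarith
      then show "k \<in> (\<Union>n<N. a - A n)"
        using n(2) by auto
    qed
    then show ?thesis
      using a(2) by (meson finite_UN_I finite_lessThan finite_subset)
  qed
  ultimately show ?thesis
    by blast
qed

section \<open>Algebras of pairs of sets\<close>

text \<open>NAND alone generates all Boolean operations, so inductions treat one operation. Pairs
  are used rather than a map because later a first coordinate determines its partner only up to a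
  null set.\<close>

inductive_set nand_closure :: "('a set \<times> 'b set) set \<Rightarrow> ('a set \<times> 'b set) set"
  for F where
  base: "p \<in> F \<Longrightarrow> p \<in> nand_closure F"
| nand: "(a, s) \<in> nand_closure F \<Longrightarrow> (b, t) \<in> nand_closure F \<Longrightarrow>
    (- (a \<inter> b), - (s \<inter> t)) \<in> nand_closure F"

lemma nand_closure_least:
  assumes "F \<subseteq> G"
    and "\<And>a s b t. (a, s) \<in> G \<Longrightarrow> (b, t) \<in> G \<Longrightarrow> (- (a \<inter> b), - (s \<inter> t)) \<in> G"
  shows "nand_closure F \<subseteq> G"
proof
  show "p \<in> G" if "p \<in> nand_closure F" for p
    using that by induction (use assms in auto)
qed

lemma nand_closure_mono: "F \<subseteq> G \<Longrightarrow> nand_closure F \<subseteq> nand_closure G"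
  by (rule nand_closure_least) (blast intro: nand_closure.intros)+

lemma nand_closure_compl: "(a, s) \<in> nand_closure F \<Longrightarrow> (- a, - s) \<in> nand_closure F"
  using nand_closure.nand[of a s F a s] by simp

lemma nand_closure_Int:
  "(a, s) \<in> nand_closure F \<Longrightarrow> (b, t) \<in> nand_closure F \<Longrightarrow> (a \<inter> b, s \<inter> t) \<in> nand_closure F"
  using nand_closure_compl[OF nand_closure.nand, of a s F b t] by simp

lemma nand_closure_Un:
  "(a, s) \<in> nand_closure F \<Longrightarrow> (b, t) \<in> nand_closure F \<Longrightarrow> (a \<union> b, s \<union> t) \<in> nand_closure F"
  using nand_closure.nand[OF nand_closure_compl nand_closure_compl, of a s F b t] by simp

lemma nand_closure_Diff:
  "(a, s) \<in> nand_closure F \<Longrightarrow> (b, t) \<in> nand_closure F \<Longrightarrow> (a - b, s - t) \<in> nand_closure F"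
  unfolding Diff_eq by (intro nand_closure_Int nand_closure_compl)

text \<open>The usual normal form in a one-generator extension of a Boolean algebra, with
  coefficients shared by both coordinates.\<close>

lemma nand_closure_insert:
  assumes "F \<noteq> {}" and "p \<in> nand_closure (insert (b, u) F)"
  shows "\<exists>a s a' s'. (a, s) \<in> nand_closure F \<and> (a', s') \<in> nand_closure F \<and>
    p = (a \<inter> b \<union> (a' - b), s \<inter> u \<union> (s' - u))"
  using assms(2)
proof induction
  case (base p)
  \<comment> \<open>Any pair of the closure yields the bottom and top pairs, which are the
    coefficients of the new generator.\<close>
  obtain c v where "(c, v) \<in> nand_closure F"
    using assms(1) by (auto intro: nand_closure.base)
  then have e: "({}, {}) \<in> nand_closure F" "(UNIV, UNIV) \<in> nand_closure F"
    using nand_closure_Diff[of c v F c v] nand_closure_Un[of c v F "- c" "- v"]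
      nand_closure_compl[of c v F] by simp_all
  show ?case
  proof (cases "p = (b, u)")
    case True
    then show ?thesis
      using e by (intro exI[of _ UNIV] exI[of _ "{}"]) auto
  next
    case False
    then have "p \<in> nand_closure F"
      using base by (auto intro: nand_closure.base)
    then show ?thesis
      by (intro exI[of _ "fst p"] exI[of _ "snd p"] conjI) (auto simp: prod_eq_iff)
  qed
next
  case (nand a1 s1 a2 s2)
  from nand.IH obtain c v c' v' d w d' w' where *:
    "(c, v) \<in> nand_closure F" "(c', v') \<in> nand_closure F"
    "(d, w) \<in> nand_closure F" "(d', w') \<in> nand_closure F"
    and eq: "a1 = c \<inter> b \<union> (c' - b)" "s1 = v \<inter> u \<union> (v' - u)"
    "a2 = d \<inter> b \<union> (d' - b)" "s2 = w \<inter> u \<union> (w' - u)"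
    by auto
  \<comment> \<open>NAND acts separately inside and outside the new generator.\<close>
  have split: "- (a1 \<inter> a2) = - (c \<inter> d) \<inter> b \<union> (- (c' \<inter> d') - b)"
    "- (s1 \<inter> s2) = - (v \<inter> w) \<inter> u \<union> (- (v' \<inter> w') - u)"
    unfolding eq by (rule set_eqI, simp, blast)+
  show ?case
    unfolding split
    by (intro exI conjI, rule nand_closure.nand[OF *(1,3)], rule nand_closure.nand[OF *(2,4)],
        rule refl)
qed

primrec nand_level :: "('a set \<times> 'b set) set \<Rightarrow> nat \<Rightarrow> ('a set \<times> 'b set) set" where
  "nand_level F 0 = F"
| "nand_level F (Suc n) = nand_level F n \<union>
    (\<lambda>((a, s), (b, t)). (- (a \<inter> b), - (s \<inter> t))) ` (nand_level F n \<times> nand_level F n)"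

lemma nand_level_mono: "m \<le> n \<Longrightarrow> nand_level F m \<subseteq> nand_level F n"
  by (rule lift_Suc_mono_le[of "nand_level F"]) auto

lemma nand_closure_subset_levels: "nand_closure F \<subseteq> (\<Union>n. nand_level F n)"
proof (rule nand_closure_least)
  show "F \<subseteq> (\<Union>n. nand_level F n)"
    using UN_upper[of 0 UNIV "nand_level F"] by simp
next
  fix a s b t
  assume "(a, s) \<in> (\<Union>n. nand_level F n)" "(b, t) \<in> (\<Union>n. nand_level F n)"
  then obtain m n where "(a, s) \<in> nand_level F m" "(b, t) \<in> nand_level F n"
    by auto
  then have "(a, s) \<in> nand_level F (max m n)" "(b, t) \<in> nand_level F (max m n)"
    using nand_level_mono[of m "max m n" F] nand_level_mono[of n "max m n" F] by auto
  then have "(- (a \<inter> b), - (s \<inter> t)) \<in> nand_level F (Suc (max m n))"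
    unfolding nand_level.simps
    by (intro UnI2 image_eqI[where x = "((a, s), (b, t))"]) simp_all
  then show "(- (a \<inter> b), - (s \<inter> t)) \<in> (\<Union>n. nand_level F n)"
    by blast
qed

text \<open>Each stage adds an image of the square of the previous one, which does not exceed an
  infinite \<open>|F|\<close>, and countably many stages exhaust the closure.\<close>

lemma card_of_nand_closure:
  assumes "infinite F"
  shows "|nand_closure F| \<le>o |F|"
proof -
  have level: "|nand_level F n| \<le>o |F|" for n
  proof (induction n)
    case 0
    show ?case by (simp add: card_of_mono1)
  next
    case (Suc n)
    have "|nand_level F n \<times> nand_level F n| \<le>o |F|"
      using assms Suc
      by (intro card_of_Times_ordLeq_infinite_Field) (simp_all add: Field_card_of card_of_card_order_on)
    then have "|(\<lambda>((a, s), (b, t)). (- (a \<inter> b), - (s \<inter> t))) `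
        (nand_level F n \<times> nand_level F n)| \<le>o |F|"
      using card_of_image ordLeq_transitive by blast
    then show ?case
      using assms Suc unfolding nand_level.simps
      by (intro card_of_Un_ordLeq_infinite_Field) (simp_all add: Field_card_of card_of_card_order_on)
  qed
  have "|UNIV :: nat set| \<le>o |F|"
    using assms infinite_iff_card_of_nat by blast
  then have "|\<Union>n. nand_level F n| \<le>o |F|"
    using level assms by (intro card_of_UNION_ordLeq_infinite) auto
  then show ?thesis
    using card_of_mono1[OF nand_closure_subset_levels] ordLeq_transitive by blast
qed

section \<open>Clopen subsets of the Cantor space\<close>

interpretation cantor: prob_space cantor_measure
  unfolding cantor_measure_def by (intro prob_space_PiM) (rule prob_space_measure_pmf)

lemma space_cantor_measure [simp]: "space cantor_measure = UNIV"
  by (auto simp: cantor_measure_def space_PiM)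

lemma cantor_cylinder:
  shows sets_cantor_cylinder: "{x. \<forall>i<n. x i = y i} \<in> sets cantor_measure"
    and measure_cantor_cylinder: "measure cantor_measure {x. \<forall>i<n. x i = y i} = (1/2) ^ n"
proof -
  let ?M = "\<lambda>_::nat. measure_pmf (pmf_of_set (UNIV :: bool set))"
  interpret product_prob_space ?M UNIV
    by (rule product_prob_spaceI) (rule prob_space_measure_pmf)
  have eq: "{x. \<forall>i<n. x i = y i} = prod_emb UNIV ?M {..<n} (PiE {..<n} (\<lambda>i. {y i}))"
    by (simp add: prod_emb_def PiE_iff space_PiM restrict_def extensional_def set_eq_iff
        Ball_def)
  show "{x. \<forall>i<n. x i = y i} \<in> sets cantor_measure"
    unfolding eq cantor_measure_def by (intro sets_PiM_I) auto
  show "measure cantor_measure {x. \<forall>i<n. x i = y i} = (1/2) ^ n"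
    unfolding eq cantor_measure_def
    by (subst measure_PiM_emb) (auto simp: measure_pmf_single)
qed

text \<open>By compactness, the sets depending on finitely many coordinates are exactly the clopen
  ones.\<close>

definition cantor_clopen :: "(nat \<Rightarrow> bool) set \<Rightarrow> bool" where
  "cantor_clopen s \<longleftrightarrow> (\<exists>n. \<forall>x y. (\<forall>i<n. x i = y i) \<longrightarrow> (x \<in> s \<longleftrightarrow> y \<in> s))"

lemma cantor_clopen_Compl: "cantor_clopen s \<Longrightarrow> cantor_clopen (- s)"
  by (simp add: cantor_clopen_def)

lemma cantor_clopen_Int:
  assumes "cantor_clopen s" "cantor_clopen t"
  shows "cantor_clopen (s \<inter> t)"
proof -
  obtain m n where *: "\<And>x y. (\<forall>i<m. x i = y i) \<Longrightarrow> x \<in> s \<longleftrightarrow> y \<in> s"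
    "\<And>x y. (\<forall>i<n. x i = y i) \<Longrightarrow> x \<in> t \<longleftrightarrow> y \<in> t"
    using assms unfolding cantor_clopen_def by metis
  have "x \<in> s \<inter> t \<longleftrightarrow> y \<in> s \<inter> t" if "\<forall>i<max m n. x i = y i" for x y
    using that *(1)[of x y] *(2)[of x y] by simp
  then show ?thesis
    unfolding cantor_clopen_def by blast
qed

lemma cantor_clopen_empty: "cantor_clopen {}"
  by (simp add: cantor_clopen_def)

lemma cantor_clopen_Un: "cantor_clopen s \<Longrightarrow> cantor_clopen t \<Longrightarrow> cantor_clopen (s \<union> t)"
  using cantor_clopen_Compl[OF cantor_clopen_Int[OF cantor_clopen_Compl cantor_clopen_Compl]]
  by simp

lemma cantor_clopen_prefix:
  assumes "cantor_clopen s"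
  obtains n L where "finite L" "s = {x. map x [0..<n] \<in> L}"
proof -
  obtain n where n: "\<And>x y. (\<forall>i<n. x i = y i) \<Longrightarrow> x \<in> s \<longleftrightarrow> y \<in> s"
    using assms unfolding cantor_clopen_def by metis
  let ?L = "(\<lambda>x. map x [0..<n]) ` s"
  have "finite ?L"
    by (rule finite_subset[OF _ finite_lists_length_eq[of UNIV n]]) auto
  moreover have "s = {x. map x [0..<n] \<in> ?L}"
  proof -
    have "x \<in> s" if "y \<in> s" "map x [0..<n] = map y [0..<n]" for x y
      using that n[of y x] by simp
    then show ?thesis
      by auto
  qed
  ultimately show thesis
    using that by blast
qed

lemma countable_cantor_clopen: "countable (Collect cantor_clopen)"
proof -
  have "Collect cantor_clopen \<subseteq>
      (\<lambda>(n, L). {x. map x [0..<n] \<in> L}) ` (UNIV \<times> Collect finite)"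
  proof
    fix s assume "s \<in> Collect cantor_clopen"
    then have "cantor_clopen s" by simp
    then obtain n L where "finite L" "s = {x. map x [0..<n] \<in> L}"
      by (rule cantor_clopen_prefix)
    then show "s \<in> (\<lambda>(n, L). {x. map x [0..<n] \<in> L}) ` (UNIV \<times> Collect finite)"
      by (intro image_eqI[where x = "(n, L)"]) simp_all
  qed
  moreover have "countable ((UNIV :: nat set) \<times> Collect (finite :: bool list set \<Rightarrow> bool))"
    by (intro countable_SIGMA countable_Collect_finite) simp
  ultimately show ?thesis
    using countable_image countable_subset by blast
qed

lemma sets_cantor_clopen:
  assumes "cantor_clopen s"
  shows "s \<in> sets cantor_measure"
proof -
  obtain n L where L: "finite L" "s = {x. map x [0..<n] \<in> L}"
    using assms by (rule cantor_clopen_prefix)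
  have "{x. map x [0..<n] = l} \<in> sets cantor_measure" for l :: "bool list"
  proof (cases "length l = n")
    case True
    then have "{x. map x [0..<n] = l} = {x. \<forall>i<n. x i = l ! i}"
      by (auto simp: list_eq_iff_nth_eq)
    then show ?thesis
      using sets_cantor_cylinder[of n "\<lambda>i. l ! i"] by simp
  next
    case False
    then have "{x. map x [0..<n] = l} = {}"
      by auto
    then show ?thesis
      by simp
  qed
  then have "(\<Union>l\<in>L. {x. map x [0..<n] = l}) \<in> sets cantor_measure"
    using L(1) by blast
  also have "(\<Union>l\<in>L. {x. map x [0..<n] = l}) = s"
    using L(2) by auto
  finally show ?thesis .
qed

lemma cantor_clopen_cylinder_subset:
  assumes "cantor_clopen s" "x \<in> s"
  obtains n where "{y. \<forall>i<n. y i = x i} \<subseteq> s"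
proof -
  obtain n where "\<And>x y. (\<forall>i<n. x i = y i) \<Longrightarrow> x \<in> s \<longleftrightarrow> y \<in> s"
    using assms(1) unfolding cantor_clopen_def by metis
  then have "{y. \<forall>i<n. y i = x i} \<subseteq> s"
    using assms(2) by auto
  then show thesis
    by (rule that)
qed

lemma measure_cantor_clopen_eq_0_iff:
  assumes "cantor_clopen s"
  shows "measure cantor_measure s = 0 \<longleftrightarrow> s = {}"
proof
  assume 0: "measure cantor_measure s = 0"
  show "s = {}"
  proof (rule ccontr)
    assume "s \<noteq> {}"
    then obtain x where "x \<in> s"
      by auto
    then obtain n where "{y. \<forall>i<n. y i = x i} \<subseteq> s"
      by (rule cantor_clopen_cylinder_subset[OF assms])
    then have "(1/2) ^ n \<le> measure cantor_measure s"
      using cantor.finite_measure_mono[OF _ sets_cantor_clopen[OF assms]]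
      unfolding measure_cantor_cylinder[of n x, symmetric] by blast
    then show False
      using 0 zero_less_power[of "1/2 :: real" n] by linarith
  qed
qed simp

text \<open>A sequence meeting every nonempty clopen set infinitely often, so that taking preimages
  embeds the clopen algebra into the subsets of \<open>\<omega>\<close> modulo finite sets.\<close>

definition cantor_seq :: "nat \<Rightarrow> nat \<Rightarrow> bool" where
  "cantor_seq k i = (case from_nat k :: bool list \<times> nat of (l, m) \<Rightarrow> i < length l \<and> l ! i)"

lemma finite_vimage_cantor_seq_iff:
  assumes "cantor_clopen s"
  shows "finite (cantor_seq -` s) \<longleftrightarrow> s = {}"
proof
  assume fin: "finite (cantor_seq -` s)"
  show "s = {}"
  proof (rule ccontr)
    assume "s \<noteq> {}"
    then obtain x where "x \<in> s"
      by auto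
    then obtain n where n: "{y. \<forall>i<n. y i = x i} \<subseteq> s"
      by (rule cantor_clopen_cylinder_subset[OF assms])
    \<comment> \<open>The component \<open>m\<close> of the code is a dummy: it repeats every
      finitely supported sequence infinitely often.\<close>
    have "range (\<lambda>m::nat. to_nat (map x [0..<n], m)) \<subseteq> cantor_seq -` s"
    proof -
      have "cantor_seq (to_nat (map x [0..<n], m)) \<in> {y. \<forall>i<n. y i = x i}" for m :: nat
        by (simp add: cantor_seq_def)
      then show ?thesis
        using n by blast
    qed
    moreover have "infinite (range (\<lambda>m::nat. to_nat (map x [0..<n], m)))"
      by (intro range_inj_infinite) (auto simp: inj_def)
    ultimately show False
      using fin finite_subset by blast
  qed
qed simp

definition cantor_nbhd :: "(nat \<Rightarrow> bool) set \<Rightarrow> nat \<Rightarrow> (nat \<Rightarrow> bool) set" where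
  "cantor_nbhd C n = {x. \<exists>y\<in>C. \<forall>i<n. y i = x i}"

lemma cantor_clopen_nbhd: "cantor_clopen (cantor_nbhd C n)"
  unfolding cantor_clopen_def cantor_nbhd_def by (intro exI[of _ n]) auto

lemma subset_cantor_nbhd: "C \<subseteq> cantor_nbhd C n"
  by (auto simp: cantor_nbhd_def)

text \<open>The neighbourhoods decrease to the closure of \<open>C\<close>, which is null by the
  definition of \<open>E_ideal\<close>. Hence \<open>C\<close> has clopen supersets of arbitrarily
  small measure.\<close>

lemma tendsto_measure_cantor_nbhd:
  assumes "C \<in> E_ideal"
  shows "(\<lambda>n. measure cantor_measure (cantor_nbhd C n)) \<longlonglongrightarrow> 0"
proof -
  have "decseq (cantor_nbhd C)"
    unfolding cantor_nbhd_def decseq_def using less_le_trans by blast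
  then have "(\<lambda>n. measure cantor_measure (cantor_nbhd C n))
      \<longlonglongrightarrow> measure cantor_measure (\<Inter>n. cantor_nbhd C n)"
    by (intro cantor.finite_Lim_measure_decseq) (auto intro: sets_cantor_clopen cantor_clopen_nbhd)
  also have "(\<Inter>n. cantor_nbhd C n) = cantor_closure C"
    by (auto simp: cantor_nbhd_def cantor_closure_def)
  also have "measure cantor_measure (cantor_closure C) = 0"
    using assms by (simp add: E_ideal_def measure_eq_0_null_sets)
  finally show ?thesis .
qed

text \<open>The bounds sum to \<open>e / 2\<close>. With \<open>e = 1\<close> this bounds a whole
  union; with \<open>e\<close> the supposedly positive measure of \<open>T\<close> itself it gives a
  contradiction.\<close>

lemma (in finite_measure) measure_le_half_of_small_cover:
  assumes "T \<subseteq> N \<union> (\<Union>k. X k)" "N \<in> sets M" "range X \<subseteq> sets M"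
    and "measure M N = 0" and X: "\<And>k. measure M (X k) \<le> e / 2 ^ (k + 2)"
  shows "measure M T \<le> e / 2"
proof -
  have sums: "(\<lambda>k. e / 2 ^ (k + 2)) sums (e / 2)"
    using sums_mult[OF geometric_sums[of "1/2 :: real"], of "e / 4"]
    by (simp add: power_add power_divide)
  have summable: "summable (\<lambda>k. measure M (X k))"
    by (rule summable_comparison_test'[OF sums_summable[OF sums], of 0]) (use X in auto)
  have "measure M T \<le> measure M (N \<union> (\<Union>k. X k))"
    using assms(1-3) by (intro finite_measure_mono) auto
  also have "\<dots> \<le> measure M N + measure M (\<Union>k. X k)"
    using assms(2,3) by (intro measure_Un_le) auto
  also have "\<dots> \<le> (\<Sum>k. measure M (X k))"
    using assms(3,4) finite_measure_subadditive_countably[OF _ summable] by simp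
  also have "\<dots> \<le> (\<Sum>k. e / 2 ^ (k + 2))"
    by (intro suminf_le X summable sums_summable[OF sums])
  also have "\<dots> = e / 2"
    using sums by (rule sums_unique[symmetric])
  finally show ?thesis .
qed

section \<open>Adjoining a closed set of positive measure\<close>

text \<open>The values \<open>h k\<close> are chosen recursively, the choice depending on the whole finite sequence
  of earlier values. Domination on finite sequences, rather than on \<open>\<omega>\<close>, makes the finitely many
  exceptions harmless: once they are passed, the part of \<open>t\<close> that is left has a known measure.\<close>

lemma (in prob_space) generic_small_union:
  fixes W :: "nat \<Rightarrow> nat \<Rightarrow> 'a set"
  assumes B: "min_unbounded_family B" "|X| <o |B|"
    and X: "X \<subseteq> sets M"
    and W: "\<And>k j. W k j \<in> sets M" "\<And>k. (\<lambda>j. measure M (W k j)) \<longlonglongrightarrow> 0"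
  shows "\<exists>h. measure M (\<Union>k. W k (h k)) \<le> 1/2 \<and>
    (\<forall>t\<in>X. measure M (t - (\<Union>k. W k (h k))) = 0 \<longrightarrow>
      (\<exists>n. measure M (t - (\<Union>k<n. W k (h k))) = 0))"
proof -
  \<comment> \<open>\<open>WL s\<close> is what a finite sequence \<open>s\<close> of choices
    removes; \<open>rest t s m\<close> measures what the first \<open>m\<close> of them leave of
    \<open>t\<close>.\<close>
  define WL where "WL s = (\<Union>i<length s. W i (s ! i))" for s
  define rest where "rest t s m = measure M (t - WL (take m s))" for t s m
  have small: "\<exists>N. \<forall>j\<ge>N. measure M (W k j) \<le> e" if "e > 0" for k e
    using order_tendstoD(2)[OF W(2) that, of k]
    by (auto simp: eventually_sequentially intro: less_imp_le)
  \<comment> \<open>How many early choices escape domination is not known in advance, so the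
    threshold serves every \<open>m \<le> length s\<close>; a maximum of finitely many bounds
    suffices.\<close>
  have "\<forall>t s. \<exists>N. \<forall>j\<ge>N. \<forall>m\<le>length s. 0 < rest t s m \<longrightarrow>
      measure M (W (length s) j) \<le> rest t s m / 2 ^ (length s + 2)"
  proof (intro allI)
    fix t s
    have "\<forall>m. \<exists>N. \<forall>j\<ge>N. 0 < rest t s m \<longrightarrow>
        measure M (W (length s) j) \<le> rest t s m / 2 ^ (length s + 2)"
    proof
      fix m
      show "\<exists>N. \<forall>j\<ge>N. 0 < rest t s m \<longrightarrow>
          measure M (W (length s) j) \<le> rest t s m / 2 ^ (length s + 2)"
      proof (cases "0 < rest t s m")
        case True
        then show ?thesis
          using small[of "rest t s m / 2 ^ (length s + 2)" "length s"] by simp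
      qed simp
    qed
    then obtain N where N: "\<And>m j. N m \<le> j \<Longrightarrow> 0 < rest t s m \<Longrightarrow>
        measure M (W (length s) j) \<le> rest t s m / 2 ^ (length s + 2)"
      by metis
    have "N m \<le> j" if "Max (N ` {..length s}) \<le> j" "m \<le> length s" for m j
      using that by (auto intro: order_trans[OF Max_ge])
    then show "\<exists>N. \<forall>j\<ge>N. \<forall>m\<le>length s. 0 < rest t s m \<longrightarrow>
        measure M (W (length s) j) \<le> rest t s m / 2 ^ (length s + 2)"
      using N by (intro exI[of _ "Max (N ` {..length s})"]) blast
  qed
  then obtain G where G: "\<And>t s j m. G t s \<le> j \<Longrightarrow> m \<le> length s \<Longrightarrow> 0 < rest t s m \<Longrightarrow>
      measure M (W (length s) j) \<le> rest t s m / 2 ^ (length s + 2)"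
    unfolding choice_iff by blast
  have "\<exists>N. \<forall>j\<ge>N. measure M (W k j) \<le> 1 / 2 ^ (k + 2)" for k
    by (intro small) simp
  then obtain G0 where G0: "\<And>k j. G0 k \<le> j \<Longrightarrow> measure M (W k j) \<le> 1 / 2 ^ (k + 2)"
    by metis
  obtain g where g: "\<And>t. t \<in> X \<Longrightarrow> finite {s. g s < G t s}"
    using min_unbounded_family_dominate_countable[OF B, of G] by blast
  \<comment> \<open>\<open>G0\<close> keeps the total measure at most 1/2, and \<open>g\<close>
    dominates every \<open>G t\<close> with \<open>t\<close> in \<open>X\<close>. Below,
    \<open>hs n\<close> is the history of the first \<open>n\<close> choices.\<close>
  define g' where "g' s = max (g s) (G0 (length s))" for s
  define hs where "hs = rec_nat [] (\<lambda>_ s. s @ [g' s])"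
  define h where "h n = g' (hs n)" for n
  have hs: "hs n = map h [0..<n]" for n
    by (induction n) (simp_all add: hs_def h_def)
  have len [simp]: "length (hs n) = n" for n
    by (simp add: hs)
  have WL_hs: "WL (hs n) = (\<Union>k<n. W k (h k))" for n
    by (simp add: WL_def hs)
  have rest_hs: "rest t (hs n) m = measure M (t - (\<Union>k<m. W k (h k)))" if "m \<le> n" for t m n
  proof -
    have "take m (hs n) = hs m"
      using that by (simp add: hs take_map)
    then show ?thesis
      by (simp add: rest_def WL_hs)
  qed
  have sets_U: "(\<Union>k. W k (h k)) \<in> sets M" "\<And>n. (\<Union>k<n. W k (h k)) \<in> sets M"
    using W(1) by auto
  have "measure M (W k (h k)) \<le> 1 / 2 ^ (k + 2)" for k
    using G0[of k "h k"] by (simp add: h_def g'_def)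
  then have "measure M (\<Union>k. W k (h k)) \<le> 1 / 2"
    using W(1) by (intro measure_le_half_of_small_cover[of _ "{}" "\<lambda>k. W k (h k)"]) auto
  moreover have "\<exists>n. measure M (t - (\<Union>k<n. W k (h k))) = 0"
    if t: "t \<in> X" and null: "measure M (t - (\<Union>k. W k (h k))) = 0" for t
  proof -
    have "finite (length ` {s. g s < G t s})"
      using g[OF t] by (rule finite_imageI)
    \<comment> \<open>Finitely many sequences are exceptional, so every history of length at least
      \<open>n\<close> is dominated.\<close>
    then obtain n where n: "\<And>s. g s < G t s \<Longrightarrow> length s < n"
      by (auto simp: finite_nat_set_iff_bounded)
    have dom: "G t (hs k) \<le> h k" if "n \<le> k" for k
      using n[of "hs k"] that by (fastforce simp: h_def g'_def)
    \<comment> \<open>If what remains of \<open>t\<close> after \<open>n\<close> choices had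
      positive measure, all later choices together would remove at most half of it and could not
      leave a null set.\<close>
    define e where "e = measure M (t - (\<Union>k<n. W k (h k)))"
    have "e = 0"
    proof (rule ccontr)
      assume "e \<noteq> 0"
      then have "e > 0"
        by (simp add: e_def zero_less_measure_iff)
      define V where "V k = (if n \<le> k then W k (h k) else {})" for k
      have V: "measure M (V k) \<le> e / 2 ^ (k + 2)" for k
      proof (cases "n \<le> k")
        case True
        then show ?thesis
          using G[OF dom[OF True], of n] rest_hs[OF True, of t] \<open>e > 0\<close>
          by (simp add: V_def e_def)
      next
        case False
        then show ?thesis
          using \<open>e > 0\<close> by (simp add: V_def)
      qed
      have sub: "t - (\<Union>k<n. W k (h k)) \<subseteq> (t - (\<Union>k. W k (h k))) \<union> (\<Union>k. V k)"
      proof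
        fix x assume x: "x \<in> t - (\<Union>k<n. W k (h k))"
        show "x \<in> (t - (\<Union>k. W k (h k))) \<union> (\<Union>k. V k)"
        proof (cases "\<exists>k. x \<in> W k (h k)")
          case True
          then obtain k where k: "x \<in> W k (h k)"
            by blast
          then have "n \<le> k"
            using x by (meson DiffD2 UN_I lessThan_iff not_less)
          then have "x \<in> V k"
            using k by (simp add: V_def)
          then show ?thesis
            by blast
        next
          case False
          then show ?thesis
            using x by blast
        qed
      qed
      have "measure M (t - (\<Union>k<n. W k (h k))) \<le> e / 2"
        by (rule measure_le_half_of_small_cover[OF sub _ _ null V])
          (use t X sets_U W(1) in \<open>auto simp: V_def\<close>)
      then have "e \<le> e / 2"
        by (simp only: e_def[symmetric])
      then show False
        using \<open>e > 0\<close> by simp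
    qed
    then show ?thesis
      unfolding e_def by blast
  qed
  ultimately show ?thesis
    by blast
qed

section \<open>Exact pairs and their one-step extensions\<close>

text \<open>A pair \<open>(a, s)\<close> records that the class of \<open>a\<close> in \<open>P(\<omega>)/fin\<close> corresponds to the class of
  \<open>s\<close> in the measure algebra.\<close>

definition exact_pairs :: "(nat set \<times> (nat \<Rightarrow> bool) set) set \<Rightarrow> bool" where
  "exact_pairs P \<longleftrightarrow> (\<forall>(a, s)\<in>P. s \<in> sets cantor_measure \<and>
     (finite a \<longleftrightarrow> measure cantor_measure s = 0))"

text \<open>The starting system of the recursion. The pairs with empty second coordinate put all
  finite sets into the algebra.\<close>

definition clopen_pairs :: "(nat set \<times> (nat \<Rightarrow> bool) set) set" where
  "clopen_pairs = (\<lambda>s. (cantor_seq -` s, s)) ` Collect cantor_clopen \<union>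
     (\<lambda>a. (a, {})) ` Collect finite"

lemma countable_clopen_pairs: "countable clopen_pairs"
  unfolding clopen_pairs_def
  by (intro countable_Un countable_image countable_cantor_clopen countable_Collect_finite)

lemma infinite_clopen_pairs: "infinite clopen_pairs"
proof
  assume "finite clopen_pairs"
  moreover have "range (\<lambda>k. ({k}, {})) \<subseteq> clopen_pairs"
    by (auto simp: clopen_pairs_def)
  moreover have "infinite (range (\<lambda>k::nat. ({k}, {} :: (nat \<Rightarrow> bool) set)))"
    by (intro range_inj_infinite) (auto simp: inj_def)
  ultimately show False
    using finite_subset by blast
qed

text \<open>Modulo finite sets, every first coordinate is the preimage of its clopen partner; a
  clopen set is null iff it is empty iff its preimage is finite.\<close>

lemma exact_nand_closure_clopen_pairs: "exact_pairs (nand_closure clopen_pairs)"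
proof -
  let ?sym = "\<lambda>a s. (a - cantor_seq -` s) \<union> (cantor_seq -` s - a)"
  have "nand_closure clopen_pairs \<subseteq> {(a, s). cantor_clopen s \<and> finite (?sym a s)}"
  proof (rule nand_closure_least)
    show "clopen_pairs \<subseteq> {(a, s). cantor_clopen s \<and> finite (?sym a s)}"
      by (auto simp: clopen_pairs_def cantor_clopen_empty)
  next
    fix a s b t
    assume *: "(a, s) \<in> {(a, s). cantor_clopen s \<and> finite (?sym a s)}"
      "(b, t) \<in> {(a, s). cantor_clopen s \<and> finite (?sym a s)}"
    have "?sym (- (a \<inter> b)) (- (s \<inter> t)) \<subseteq> ?sym a s \<union> ?sym b t"
      by auto
    then have "finite (?sym (- (a \<inter> b)) (- (s \<inter> t)))"
      by (rule finite_subset) (use * in simp)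
    moreover have "cantor_clopen (- (s \<inter> t))"
      using * by (intro cantor_clopen_Compl cantor_clopen_Int) auto
    ultimately show "(- (a \<inter> b), - (s \<inter> t)) \<in> {(a, s). cantor_clopen s \<and> finite (?sym a s)}"
      by blast
  qed
  moreover have "finite a \<longleftrightarrow> finite (cantor_seq -` s)" if "finite (?sym a s)" for a s
  proof -
    have "a \<subseteq> cantor_seq -` s \<union> ?sym a s" "cantor_seq -` s \<subseteq> a \<union> ?sym a s"
      by auto
    then show ?thesis
      using that by (meson finite_Un finite_subset)
  qed
  ultimately have "s \<in> sets cantor_measure \<and> (finite a \<longleftrightarrow> measure cantor_measure s = 0)"
    if "(a, s) \<in> nand_closure clopen_pairs" for a s
    using that finite_vimage_cantor_seq_iff[of s] measure_cantor_clopen_eq_0_iff[of s]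
      sets_cantor_clopen[of s] by blast
  then show ?thesis
    by (auto simp: exact_pairs_def)
qed

text \<open>The normal form splits each new pair into disjoint pieces inside and outside the new
  generator, so exactness need only be tested on such pieces.\<close>

lemma exact_pairs_insert:
  assumes F: "F \<noteq> {}" "exact_pairs (nand_closure F)" and u: "u \<in> sets cantor_measure"
    and Int: "\<And>a s. (a, s) \<in> nand_closure F \<Longrightarrow>
      finite (a \<inter> b) \<longleftrightarrow> measure cantor_measure (s \<inter> u) = 0"
    and Diff: "\<And>a s. (a, s) \<in> nand_closure F \<Longrightarrow>
      finite (a - b) \<longleftrightarrow> measure cantor_measure (s - u) = 0"
  shows "exact_pairs (nand_closure (insert (b, u) F))"
  unfolding exact_pairs_def
proof (rule ballI, rule case_prodI2)
  fix p c v
  assume "p \<in> nand_closure (insert (b, u) F)" "p = (c, v)"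
  then obtain a s a' s' where *: "(a, s) \<in> nand_closure F" "(a', s') \<in> nand_closure F"
    and eq: "c = a \<inter> b \<union> (a' - b)" "v = s \<inter> u \<union> (s' - u)"
    using nand_closure_insert[OF F(1)] by blast
  have "s \<in> sets cantor_measure" "s' \<in> sets cantor_measure"
    using * F(2) by (auto simp: exact_pairs_def)
  then have sets: "s \<inter> u \<in> sets cantor_measure" "s' - u \<in> sets cantor_measure"
    using u by auto
  then have "measure cantor_measure v = measure cantor_measure (s \<inter> u)
      + measure cantor_measure (s' - u)"
    unfolding eq by (intro cantor.finite_measure_Union) auto
  then have "measure cantor_measure v = 0 \<longleftrightarrow>
      measure cantor_measure (s \<inter> u) = 0 \<and> measure cantor_measure (s' - u) = 0"
    by (simp add: add_nonneg_eq_0_iff)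
  then show "v \<in> sets cantor_measure \<and> (finite c \<longleftrightarrow> measure cantor_measure v = 0)"
    using sets Int[OF *(1)] Diff[OF *(2)] by (simp add: eq)
qed

text \<open>The successor step. The clopen complements of \<open>V n\<close> decrease to
  \<open>u\<close>, and \<open>b\<close> is a pseudo-intersection of their preimages
  \<open>A n\<close>. Genericity of \<open>u\<close> is what makes \<open>a \<inter> b\<close>
  finite when \<open>s \<inter> u\<close> is null.\<close>

lemma exact_pairs_extend:
  assumes B: "min_unbounded_family B" and F: "clopen_pairs \<subseteq> F" "|F| <o |B|"
    and exact: "exact_pairs (nand_closure F)"
    and Y: "countable Y" "Y \<subseteq> E_ideal"
  shows "\<exists>b u. exact_pairs (nand_closure (insert (b, u) F)) \<and> measure cantor_measure u \<noteq> 0 \<and>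
    (\<forall>C\<in>Y. \<exists>c. cantor_clopen c \<and> C \<subseteq> c \<and> finite (b \<inter> cantor_seq -` c))"
proof -
  let ?P = "nand_closure F"
  have "infinite F"
    using F(1) infinite_clopen_pairs finite_subset by blast
  then have P_less: "|?P| <o |B|"
    using card_of_nand_closure F(2) ordLeq_ordLess_trans by blast
  have clopen_P: "(cantor_seq -` s, s) \<in> ?P" if "cantor_clopen s" for s
    using that F(1) by (auto simp: clopen_pairs_def intro: nand_closure.base)
  have exactD: "s \<in> sets cantor_measure" "finite a \<longleftrightarrow> measure cantor_measure s = 0"
    if "(a, s) \<in> ?P" for a s
    using that exact by (auto simp: exact_pairs_def)
  \<comment> \<open>Adding the empty set leaves something to enumerate when \<open>Y\<close> is
    empty.\<close>
  define C where "C = from_nat_into (insert {} Y)"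
  have "{} \<in> E_ideal"
    by (simp add: E_ideal_def cantor_closure_def)
  then have C_E: "C k \<in> E_ideal" for k
    using from_nat_into[of "insert {} Y" k] Y(2) by (auto simp: C_def)
  have "|snd ` ?P| <o |B|"
    using card_of_image P_less ordLeq_ordLess_trans by blast
  then obtain h where h: "measure cantor_measure (\<Union>k. cantor_nbhd (C k) (h k)) \<le> 1/2"
    and dich: "\<And>t. t \<in> snd ` ?P \<Longrightarrow>
      measure cantor_measure (t - (\<Union>k. cantor_nbhd (C k) (h k))) = 0 \<Longrightarrow>
      \<exists>n. measure cantor_measure (t - (\<Union>k<n. cantor_nbhd (C k) (h k))) = 0"
    using cantor.generic_small_union[OF B, of "snd ` ?P" "\<lambda>k. cantor_nbhd (C k)"]
      exactD(1) sets_cantor_clopen[OF cantor_clopen_nbhd] tendsto_measure_cantor_nbhd[OF C_E]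
    by (metis (no_types, lifting) image_subset_iff prod.collapse)
  define V where "V n = (\<Union>k<n. cantor_nbhd (C k) (h k))" for n
  define u where "u = - (\<Union>k. cantor_nbhd (C k) (h k))"
  define A where "A n = cantor_seq -` (- V n)" for n
  have V: "cantor_clopen (V n)" for n
  proof (induction n)
    case 0
    show ?case by (simp add: V_def cantor_clopen_empty)
  next
    case (Suc n)
    have "V (Suc n) = cantor_nbhd (C n) (h n) \<union> V n"
      by (auto simp: V_def less_Suc_eq)
    then show ?case
      using Suc by (simp add: cantor_clopen_Un cantor_clopen_nbhd)
  qed
  have u_V: "u = - (\<Union>n. V n)"
    by (auto simp: u_def V_def)
  have u_sets: "u \<in> sets cantor_measure"
  proof -
    have "(\<Union>n. V n) \<in> sets cantor_measure"
      using sets_cantor_clopen[OF V] by (intro sets.countable_UN) auto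
    then show ?thesis
      using sets.compl_sets[of "\<Union>n. V n" cantor_measure] by (simp add: u_V Compl_eq_Diff_UNIV)
  qed
  have "decseq A"
    unfolding decseq_def A_def V_def by fastforce
  have "|fst ` ?P| <o |B|"
    using card_of_image P_less ordLeq_ordLess_trans by blast
  from pseudo_intersection_below_bounding[OF B this \<open>decseq A\<close>]
  obtain b where b_A: "\<And>n. finite (b - A n)"
    and b_Int: "\<And>a s. (a, s) \<in> ?P \<Longrightarrow> (\<And>n. infinite (a \<inter> A n)) \<Longrightarrow> infinite (a \<inter> b)"
    and b_Diff: "\<And>a s. (a, s) \<in> ?P \<Longrightarrow> (\<And>n. finite (a - A n)) \<Longrightarrow> finite (a - b)"
    by (metis fst_conv image_eqI)
  \<comment> \<open>As \<open>V n\<close> is clopen, \<open>A n\<close> and \<open>- V n\<close>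
    form a pair of the old closure, where exactness is known.\<close>
  have A_Int: "finite (a \<inter> A n) \<longleftrightarrow> measure cantor_measure (s - V n) = 0"
    and A_Diff: "finite (a - A n) \<longleftrightarrow> measure cantor_measure (s \<inter> V n) = 0"
    if "(a, s) \<in> ?P" for a s n
    using exactD(2)[OF nand_closure_Int[OF that clopen_P[OF cantor_clopen_Compl[OF V]]], of n]
      exactD(2)[OF nand_closure_Diff[OF that clopen_P[OF cantor_clopen_Compl[OF V]]], of n]
    by (simp_all add: A_def Diff_eq)
  have "finite (a \<inter> b) \<longleftrightarrow> measure cantor_measure (s \<inter> u) = 0" if as: "(a, s) \<in> ?P" for a s
  proof
    assume "finite (a \<inter> b)"
    then obtain n where "finite (a \<inter> A n)"
      using b_Int[OF as] by blast
    then have "measure cantor_measure (s - V n) = 0"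
      using A_Int[OF as] by blast
    moreover have "measure cantor_measure (s \<inter> u) \<le> measure cantor_measure (s - V n)"
      using exactD(1)[OF as] sets_cantor_clopen[OF V]
      by (intro cantor.finite_measure_mono) (auto simp: u_V)
    ultimately show "measure cantor_measure (s \<inter> u) = 0"
      by (simp add: measure_le_0_iff)
  next
    assume "measure cantor_measure (s \<inter> u) = 0"
    \<comment> \<open>\<open>dich\<close> moves nullity from the limit \<open>u\<close> to a finite
      stage, which the old closure can see.\<close>
    then obtain n where "measure cantor_measure (s - V n) = 0"
      using dich[of s] as by (force simp: u_def V_def Diff_eq)
    then have "finite (a \<inter> A n)"
      using A_Int[OF as] by blast
    moreover have "a \<inter> b \<subseteq> (a \<inter> A n) \<union> (b - A n)"
      by auto
    ultimately show "finite (a \<inter> b)"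
      using b_A[of n] by (meson finite_Un finite_subset)
  qed
  moreover have "finite (a - b) \<longleftrightarrow> measure cantor_measure (s - u) = 0"
    if as: "(a, s) \<in> ?P" for a s
  proof
    assume fin: "finite (a - b)"
    have "measure cantor_measure (s \<inter> V n) = 0" for n
    proof -
      have "a - A n \<subseteq> (a - b) \<union> (b - A n)"
        by auto
      then have "finite (a - A n)"
        using fin b_A[of n] by (meson finite_Un finite_subset)
      then show ?thesis
        using A_Diff[OF as] by blast
    qed
    \<comment> \<open>Countable additivity passes from the single \<open>V n\<close> to their
      union.\<close>
    then have "s \<inter> V n \<in> null_sets cantor_measure" for n
      using exactD(1)[OF as] sets_cantor_clopen[OF V, of n]
      by (auto simp: null_sets_def cantor.emeasure_eq_measure)
    then have "(\<Union>n. s \<inter> V n) \<in> null_sets cantor_measure"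
      by (rule null_sets_UN)
    moreover have "s - u = (\<Union>n. s \<inter> V n)"
      by (auto simp: u_V)
    ultimately show "measure cantor_measure (s - u) = 0"
      by (simp add: measure_eq_0_null_sets)
  next
    assume null: "measure cantor_measure (s - u) = 0"
    have "finite (a - A n)" for n
    proof -
      have "measure cantor_measure (s \<inter> V n) \<le> measure cantor_measure (s - u)"
        using exactD(1)[OF as] u_sets by (intro cantor.finite_measure_mono) (auto simp: u_V)
      then show ?thesis
        using null A_Diff[OF as] by (simp add: measure_le_0_iff)
    qed
    then show "finite (a - b)"
      by (rule b_Diff[OF as])
  qed
  ultimately have "exact_pairs (nand_closure (insert (b, u) F))"
    using \<open>infinite F\<close> exact u_sets by (intro exact_pairs_insert) auto
  moreover have "measure cantor_measure u \<noteq> 0"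
  proof -
    have "(\<Union>k. cantor_nbhd (C k) (h k)) \<in> sets cantor_measure"
      using sets_cantor_clopen[OF cantor_clopen_nbhd] by auto
    then have "measure cantor_measure u = 1 - measure cantor_measure (\<Union>k. cantor_nbhd (C k) (h k))"
      unfolding u_def using cantor.prob_compl by (simp add: Compl_eq_Diff_UNIV)
    then show ?thesis
      using h by simp
  qed
  moreover have "\<exists>c. cantor_clopen c \<and> D \<subseteq> c \<and> finite (b \<inter> cantor_seq -` c)" if "D \<in> Y" for D
  proof -
    obtain k where "D = C k"
      using \<open>D \<in> Y\<close> Y(1) from_nat_into_surj[of "insert {} Y" D] by (auto simp: C_def)
    \<comment> \<open>The index \<open>k\<close> enters the union at \<open>V (Suc k)\<close>, so
      \<open>A (Suc k)\<close> misses the preimage of this neighbourhood.\<close>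
    have "b \<inter> cantor_seq -` cantor_nbhd (C k) (h k) \<subseteq> b - A (Suc k)"
      by (auto simp: A_def V_def)
    then have "finite (b \<inter> cantor_seq -` cantor_nbhd (C k) (h k))"
      using b_A finite_subset by blast
    then show ?thesis
      using cantor_clopen_nbhd subset_cantor_nbhd \<open>D = C k\<close> by blast
  qed
  ultimately show ?thesis
    by blast
qed

section \<open>The transfinite construction\<close>

text \<open>A NAND step has two premises, and the larger of two members of the chain accounts for
  both.\<close>

lemma nand_closure_Union_chain:
  assumes "\<And>S T. S \<in> \<S> \<Longrightarrow> T \<in> \<S> \<Longrightarrow> S \<subseteq> T \<or> T \<subseteq> S"
  shows "nand_closure (\<Union>\<S>) \<subseteq> (\<Union>S\<in>\<S>. nand_closure S)"
proof (rule nand_closure_least)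
  show "\<Union>\<S> \<subseteq> (\<Union>S\<in>\<S>. nand_closure S)"
    by (blast intro: nand_closure.base)
next
  fix a s b t
  assume "(a, s) \<in> (\<Union>S\<in>\<S>. nand_closure S)" "(b, t) \<in> (\<Union>S\<in>\<S>. nand_closure S)"
  then obtain S T where ST: "S \<in> \<S>" "T \<in> \<S>" "(a, s) \<in> nand_closure S" "(b, t) \<in> nand_closure T"
    by blast
  define U where "U = (if S \<subseteq> T then T else S)"
  have "U \<in> \<S>" "S \<subseteq> U" "T \<subseteq> U"
    using ST(1,2) assms[OF ST(1,2)] by (auto simp: U_def)
  then have "(- (a \<inter> b), - (s \<inter> t)) \<in> nand_closure U"
    using ST(3,4) nand_closure_mono by (blast intro: nand_closure.nand)
  then show "(- (a \<inter> b), - (s \<inter> t)) \<in> (\<Union>S\<in>\<S>. nand_closure S)"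
    using \<open>U \<in> \<S>\<close> by blast
qed

text \<open>Exactness is a condition on single pairs, so it passes to the union of the chain of
  closed initial segments. This serves every stage of the recursion as well as its end.\<close>

lemma exact_pairs_Union_segments:
  assumes r: "Well_order r" and J: "J \<subseteq> Field r"
    and exact: "\<And>Z. Z \<in> J \<Longrightarrow>
      exact_pairs (nand_closure (insert (f Z) (clopen_pairs \<union> f ` underS r Z)))"
  shows "exact_pairs (nand_closure (clopen_pairs \<union> f ` J))"
proof -
  define seg where "seg Z = insert (f Z) (clopen_pairs \<union> f ` underS r Z)" for Z
  \<comment> \<open>The member \<open>clopen_pairs\<close> covers the case of empty
    \<open>J\<close>.\<close>
  let ?S = "insert clopen_pairs (seg ` J)"
  have total: "(Z, Z') \<in> r \<or> (Z', Z) \<in> r" if "Z \<in> J" "Z' \<in> J" for Z Z'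
    using that J r by (meson subsetD wo_rel.TOTALS wo_rel.intro)
  have "trans r"
    using r by (simp add: wo_rel.TRANS wo_rel_def)
  have seg_mono: "seg Z \<subseteq> seg Z'" if "(Z, Z') \<in> r" for Z Z'
  proof -
    have "insert Z (underS r Z) \<subseteq> insert Z' (underS r Z')"
      using that \<open>trans r\<close> by (auto simp: underS_def dest: transD)
    then have "f ` insert Z (underS r Z) \<subseteq> f ` insert Z' (underS r Z')"
      by (rule image_mono)
    then show ?thesis
      by (auto simp: seg_def)
  qed
  have "clopen_pairs \<union> f ` J \<subseteq> \<Union>?S"
    by (auto simp: seg_def)
  then have "nand_closure (clopen_pairs \<union> f ` J) \<subseteq> nand_closure (\<Union>?S)"
    by (rule nand_closure_mono)
  also have "\<dots> \<subseteq> (\<Union>S\<in>?S. nand_closure S)"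
  proof (rule nand_closure_Union_chain)
    fix S T assume "S \<in> ?S" "T \<in> ?S"
    then consider "S = clopen_pairs" | "T = clopen_pairs"
      | Z Z' where "S = seg Z" "T = seg Z'" "Z \<in> J" "Z' \<in> J"
      by blast
    then show "S \<subseteq> T \<or> T \<subseteq> S"
    proof cases
      case 3
      then show ?thesis
        using total seg_mono by blast
    qed (use \<open>S \<in> ?S\<close> \<open>T \<in> ?S\<close> in \<open>auto simp: seg_def\<close>)
  qed
  finally have sub: "nand_closure (clopen_pairs \<union> f ` J) \<subseteq> (\<Union>S\<in>?S. nand_closure S)" .
  have exact_seg: "exact_pairs (nand_closure S)" if "S \<in> ?S" for S
    using that exact exact_nand_closure_clopen_pairs by (auto simp: seg_def)
  show ?thesis
    unfolding exact_pairs_def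
  proof
    fix p assume "p \<in> nand_closure (clopen_pairs \<union> f ` J)"
    then obtain S where "S \<in> ?S" "p \<in> nand_closure S"
      using sub by blast
    then show "case p of (a, s) \<Rightarrow> s \<in> sets cantor_measure \<and>
        (finite a \<longleftrightarrow> measure cantor_measure s = 0)"
      using exact_seg unfolding exact_pairs_def by (meson bspec)
  qed
qed

text \<open>Recursion along the cardinal order of \<open>D\<close>: a proper initial segment is
  smaller than \<open>D\<close>, hence below \<bb>, and adding the countable starting system keeps
  it there. So the successor step always applies.\<close>

lemma exact_pairs_family:
  assumes B: "min_unbounded_family B" and D: "|D| \<le>o |B|"
    and Y: "\<And>Y. Y \<in> D \<Longrightarrow> countable Y \<and> Y \<subseteq> E_ideal"
  shows "\<exists>f. exact_pairs (nand_closure (clopen_pairs \<union> f ` D)) \<and>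
    (\<forall>Y\<in>D. measure cantor_measure (snd (f Y)) \<noteq> 0 \<and>
      (\<forall>C\<in>Y. \<exists>c. cantor_clopen c \<and> C \<subseteq> c \<and> finite (fst (f Y) \<inter> cantor_seq -` c)))"
proof -
  define r where "r = |D|"
  have r: "Well_order r" "Card_order r" "Field r = D"
    unfolding r_def by (rule card_of_Well_order card_of_Card_order Field_card_of)+
  define good where "good Y p \<longleftrightarrow> measure cantor_measure (snd p) \<noteq> 0 \<and>
      (\<forall>C\<in>Y. \<exists>c. cantor_clopen c \<and> C \<subseteq> c \<and> finite (fst p \<inter> cantor_seq -` c))"
    for Y and p :: "nat set \<times> (nat \<Rightarrow> bool) set"
  \<comment> \<open>Outside \<open>D\<close> the condition is vacuous, since the recursion runs over
    the whole type.\<close>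
  define Q where "Q f Y p \<longleftrightarrow> (Y \<in> D \<longrightarrow> good Y p \<and>
      exact_pairs (nand_closure (insert p (clopen_pairs \<union> f ` underS r Y))))" for f Y p
  have "infinite B"
    using countable_less_min_unbounded_family[OF B countable_finite] ordLess_irreflexive by blast
  have "\<exists>f. \<forall>Y. Q f Y (f Y)"
  proof (rule dependent_wf_choice)
    show "wf (r - Id)"
      using r(1) by (simp add: well_order_on_def)
  next
    fix f g :: "(nat \<Rightarrow> bool) set set \<Rightarrow> nat set \<times> (nat \<Rightarrow> bool) set" and Y p
    assume "\<And>Z. (Z, Y) \<in> r - Id \<Longrightarrow> f Z = g Z"
    then have "f ` underS r Y = g ` underS r Y"
      by (intro image_cong) (auto simp: underS_def)
    then show "Q f Y p = Q g Y p"
      by (simp add: Q_def)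
  next
    fix Y and f :: "(nat \<Rightarrow> bool) set set \<Rightarrow> nat set \<times> (nat \<Rightarrow> bool) set"
    assume IH: "\<And>Z. (Z, Y) \<in> r - Id \<Longrightarrow> Q f Z (f Z)"
    show "\<exists>p. Q f Y p"
    proof (cases "Y \<in> D")
      case True
      have sub: "underS r Y \<subseteq> D"
        unfolding r(3)[symmetric] by (auto simp: underS_def Field_def)
      have "exact_pairs (nand_closure (insert (f Z) (clopen_pairs \<union> f ` underS r Z)))"
        if "Z \<in> underS r Y" for Z
        using IH[of Z] that sub by (auto simp: Q_def underS_def)
      then have exact: "exact_pairs (nand_closure (clopen_pairs \<union> f ` underS r Y))"
        using sub r by (intro exact_pairs_Union_segments) auto
      have "|underS r Y| <o |B|"
        using card_of_underS[OF r(2)] True D r(3) ordLess_ordLeq_trans unfolding r_def by blast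
      then have "|f ` underS r Y| <o |B|"
        using card_of_image ordLeq_ordLess_trans by blast
      then have "|clopen_pairs \<union> f ` underS r Y| <o |B|"
        using \<open>infinite B\<close> countable_less_min_unbounded_family[OF B countable_clopen_pairs]
        by (intro card_of_Un_ordLess_infinite)
      from exact_pairs_extend[OF B _ this exact, of Y] Y[OF True]
      obtain b u where "exact_pairs (nand_closure (insert (b, u) (clopen_pairs \<union> f ` underS r Y)))"
        "good Y (b, u)"
        by (auto simp: good_def)
      then show ?thesis
        unfolding Q_def by blast
    qed (simp add: Q_def)
  qed
  then obtain f where f: "\<And>Y. Q f Y (f Y)"
    by blast
  then have "exact_pairs (nand_closure (clopen_pairs \<union> f ` D))"
    using r by (intro exact_pairs_Union_segments[of r]) (auto simp: Q_def)
  moreover have "\<forall>Y\<in>D. good Y (f Y)"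
    using f by (auto simp: Q_def)
  ultimately show ?thesis
    unfolding good_def by blast
qed

section \<open>The measure on the algebra of first coordinates\<close>

text \<open>Take \<open>\<mu> a\<close> to be the measure of any partner of \<open>a\<close>. Two
  partners \<open>s\<close>, \<open>t\<close> differ by null sets because \<open>s - t\<close> is
  paired with the empty set; likewise disjoint sets have partners with null intersection. Exactness
  then says that \<open>\<mu>\<close> vanishes just on finite sets.\<close>

lemma exact_pairs_imp_almost_strictly_positive:
  assumes F: "clopen_pairs \<subseteq> F" and exact: "exact_pairs (nand_closure F)"
  defines "\<A> \<equiv> fst ` nand_closure F"
  shows "\<exists>\<mu>. algebra UNIV \<A> \<and> {A. finite A} \<subseteq> \<A> \<and>
    finitely_additive_prob \<A> \<mu> \<and> almost_strictly_positive \<A> \<mu>"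
proof -
  let ?P = "nand_closure F"
  let ?m = "measure cantor_measure"
  have exactD: "s \<in> sets cantor_measure" "finite a \<longleftrightarrow> ?m s = 0" if "(a, s) \<in> ?P" for a s
    using that exact by (auto simp: exact_pairs_def)
  have fin: "(a, {}) \<in> ?P" if "finite a" for a
    using that F by (auto simp: clopen_pairs_def intro: nand_closure.base)
  have UNIV_P: "(UNIV, UNIV) \<in> ?P"
    using nand_closure_compl[OF fin[of "{}"]] by simp
  have le: "?m s \<le> ?m t" if "(a, s) \<in> ?P" "(a, t) \<in> ?P" for a s t
  proof -
    have "?m (s - t) = 0"
      using exactD(2)[OF nand_closure_Diff[OF that]] by simp
    moreover have "?m s \<le> ?m (t \<union> (s - t))"
      using that exactD(1) by (intro cantor.finite_measure_mono) auto
    moreover have "?m (t \<union> (s - t)) \<le> ?m t + ?m (s - t)"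
      using that exactD(1) by (intro measure_Un_le) auto
    ultimately show ?thesis
      by simp
  qed
  define \<mu> where "\<mu> a = ?m (SOME s. (a, s) \<in> ?P)" for a
  have \<mu>: "\<mu> a = ?m s" if "(a, s) \<in> ?P" for a s
  proof -
    have "(a, SOME s. (a, s) \<in> ?P) \<in> ?P"
      using that by (rule someI)
    then show ?thesis
      using that le by (intro antisym) (auto simp: \<mu>_def)
  qed
  have "algebra UNIV \<A>"
    unfolding algebra_iff_Un \<A>_def
  proof (intro conjI ballI)
    show "{} \<in> fst ` ?P"
      using fin[of "{}"] by force
  next
    fix a assume "a \<in> fst ` ?P"
    then obtain s where "(a, s) \<in> ?P"
      by auto
    then show "UNIV - a \<in> fst ` ?P"
      using nand_closure_Diff[OF UNIV_P] by (metis fst_conv image_eqI)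
  next
    fix a b assume "a \<in> fst ` ?P" "b \<in> fst ` ?P"
    then obtain s t where "(a, s) \<in> ?P" "(b, t) \<in> ?P"
      by auto
    then show "a \<union> b \<in> fst ` ?P"
      using nand_closure_Un by (metis fst_conv image_eqI)
  qed simp
  moreover have "{A. finite A} \<subseteq> \<A>"
  proof
    fix a :: "nat set" assume "a \<in> {A. finite A}"
    then have "(a, {}) \<in> ?P"
      by (simp add: fin)
    then show "a \<in> \<A>"
      unfolding \<A>_def by (metis fst_conv image_eqI)
  qed
  moreover have "finitely_additive_prob \<A> \<mu>"
    unfolding finitely_additive_prob_def
  proof (intro conjI ballI impI)
    show "0 \<le> \<mu> a" for a
      by (simp add: \<mu>_def)
    show "\<mu> UNIV = 1"
      using \<mu>[OF UNIV_P] cantor.prob_space by simp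
  next
    fix a b assume "a \<in> \<A>" "b \<in> \<A>" and disj: "a \<inter> b = {}"
    then obtain s t where st: "(a, s) \<in> ?P" "(b, t) \<in> ?P"
      by (auto simp: \<A>_def)
    have "?m (s \<inter> t) = 0"
      using exactD(2)[OF nand_closure_Int[OF st]] disj by simp
    moreover have "?m (s \<union> t) = ?m s + ?m t - ?m (s \<inter> t)"
      using st exactD(1) by (intro measure_Un3) (auto simp: cantor.fmeasurable_eq_sets)
    ultimately show "\<mu> (a \<union> b) = \<mu> a + \<mu> b"
      using \<mu>[OF st(1)] \<mu>[OF st(2)] \<mu>[OF nand_closure_Un[OF st]] by simp
  qed
  moreover have "almost_strictly_positive \<A> \<mu>"
    unfolding almost_strictly_positive_def \<A>_def using exactD(2) \<mu> by auto
  ultimately show ?thesis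
    by blast
qed

section \<open>Centred families and failure of \<sigma>-centredness\<close>

text \<open>Compactness of the Cantor space: bits are chosen one by one so that the preimage of the
  current cylinder stays compatible with \<open>F\<close>.\<close>

lemma centred_mod_fin_cluster_point:
  assumes "centred_mod_fin F"
  shows "\<exists>x. \<forall>A\<in>F. \<forall>n. infinite (A \<inter> cantor_seq -` {y. \<forall>i<n. y i = x i})"
proof -
  define cyl where "cyl l = cantor_seq -` {y. \<forall>i<length l. y i = l ! i}" for l
  \<comment> \<open>All finite meets are demanded, not just single members: if both extensions fail,
    with \<open>S\<close> and \<open>T\<close>, then \<open>S \<union> T\<close> refutes
    \<open>Q l\<close>.\<close>
  define Q where "Q l \<longleftrightarrow> (\<forall>S. S \<subseteq> F \<and> finite S \<longrightarrow> infinite (cyl l \<inter> \<Inter>S))" for l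
  have step: "\<exists>b. Q (l @ [b])" if "Q l" for l
  proof (rule ccontr)
    assume "\<nexists>b. Q (l @ [b])"
    then have "\<not> Q (l @ [True])" "\<not> Q (l @ [False])"
      by blast+
    then obtain S T where S: "S \<subseteq> F" "finite S" "finite (cyl (l @ [True]) \<inter> \<Inter>S)"
      and T: "T \<subseteq> F" "finite T" "finite (cyl (l @ [False]) \<inter> \<Inter>T)"
      unfolding Q_def by blast
    have "cyl l \<subseteq> cyl (l @ [True]) \<union> cyl (l @ [False])"
      by (auto simp: cyl_def less_Suc_eq nth_append)
    then have "cyl l \<inter> \<Inter>(S \<union> T) \<subseteq> (cyl (l @ [True]) \<inter> \<Inter>S) \<union> (cyl (l @ [False]) \<inter> \<Inter>T)"
      by blast
    then have "finite (cyl l \<inter> \<Inter>(S \<union> T))"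
      by (rule finite_subset) (use S(3) T(3) in simp)
    then show False
      using \<open>Q l\<close> S T unfolding Q_def by (metis Un_subset_iff finite_UnI)
  qed
  define x where "x = (\<lambda>l. SOME b. Q (l @ [b]))"
  define ls where "ls = rec_nat [] (\<lambda>_ l. l @ [x l])"
  have ls: "ls n = map (\<lambda>k. x (ls k)) [0..<n]" for n
    by (induction n) (simp_all add: ls_def)
  have Q: "Q (ls n)" for n
  proof (induction n)
    case 0
    show ?case
      using assms by (simp add: Q_def ls_def cyl_def centred_mod_fin_def)
  next
    case (Suc n)
    then show ?case
      using someI_ex[OF step] by (simp add: ls_def x_def)
  qed
  have "infinite (A \<inter> cantor_seq -` {y. \<forall>i<n. y i = x (ls i)})" if "A \<in> F" for A n
  proof -
    have "length (ls n) = n"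
      by (subst ls) simp
    moreover have "ls n ! i = x (ls i)" if "i < n" for i
      by (subst ls) (use that in simp)
    ultimately have "cyl (ls n) = cantor_seq -` {y. \<forall>i<n. y i = x (ls i)}"
      by (auto simp: cyl_def)
    then show ?thesis
      using Q[of n] \<open>A \<in> F\<close> unfolding Q_def
      by (metis Inter_insert Int_commute Inf_empty bot.extremum finite.emptyI finite_insert
          inf_top_right insert_subset)
  qed
  then show ?thesis
    by (intro exI[of _ "\<lambda>i. x (ls i)"]) blast
qed

theorem theorem2p2:
  assumes "hyp_star"
  shows "\<exists>(\<A> :: nat set set) (\<mu> :: nat set \<Rightarrow> real).
           algebra UNIV \<A> \<and> {A. finite A} \<subseteq> \<A> \<and>
           finitely_additive_prob \<A> \<mu> \<and>
           \<not> quotient_sigma_centred \<A> \<and>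
           almost_strictly_positive \<A> \<mu>"
proof -
  obtain \<C> B D where C: "\<C> \<subseteq> E_ideal" "\<Union>\<C> = UNIV" and B: "min_unbounded_family B"
    and D: "cofinal_countable_family \<C> D" and DB: "|D| \<le>o |B|"
    using assms by (auto simp: hyp_star_def min_E_cover_def E_cover_def)
  have "countable Y \<and> Y \<subseteq> E_ideal" if "Y \<in> D" for Y
    using D C(1) that by (auto simp: cofinal_countable_family_def)
  from exact_pairs_family[OF B DB this]
  obtain f where exact: "exact_pairs (nand_closure (clopen_pairs \<union> f ` D))"
    and pos: "\<And>Y. Y \<in> D \<Longrightarrow> measure cantor_measure (snd (f Y)) \<noteq> 0"
    and avoid: "\<And>Y C. Y \<in> D \<Longrightarrow> C \<in> Y \<Longrightarrow>
      \<exists>c. cantor_clopen c \<and> C \<subseteq> c \<and> finite (fst (f Y) \<inter> cantor_seq -` c)"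
    by blast
  define P where "P = nand_closure (clopen_pairs \<union> f ` D)"
  obtain \<mu> where \<mu>: "algebra UNIV (fst ` P)" "{A. finite A} \<subseteq> fst ` P"
    "finitely_additive_prob (fst ` P) \<mu>" "almost_strictly_positive (fst ` P) \<mu>"
    using exact_pairs_imp_almost_strictly_positive[OF _ exact] unfolding P_def by blast
  have "\<not> quotient_sigma_centred (fst ` P)"
  proof
    assume "quotient_sigma_centred (fst ` P)"
    then obtain F :: "nat \<Rightarrow> nat set set" where F: "\<And>n. centred_mod_fin (F n)"
      and cover: "{A \<in> fst ` P. infinite A} \<subseteq> (\<Union>n. F n)"
      by (auto simp: quotient_sigma_centred_def)
    obtain x where x: "\<And>n A m. A \<in> F n \<Longrightarrow>
        infinite (A \<inter> cantor_seq -` {y. \<forall>i<m. y i = x n i})"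
      using centred_mod_fin_cluster_point[OF F] by metis
    \<comment> \<open>Each cluster point lies in a member of the cover; cofinality then puts these
      countably many members into one \<open>Y\<close> of \<open>D\<close>.\<close>
    have "\<forall>n. \<exists>C\<in>\<C>. x n \<in> C"
      using C(2) by blast
    then obtain C where C_x: "\<And>n. C n \<in> \<C>" "\<And>n. x n \<in> C n"
      by metis
    have "range C \<subseteq> \<C> \<and> countable (range C)"
      using C_x(1) by auto
    then obtain Y where Y: "Y \<in> D" "range C \<subseteq> Y"
      using D unfolding cofinal_countable_family_def by (elim conjE allE[of _ "range C"]) blast
    have "f Y \<in> P"
      using Y(1) by (auto simp: P_def intro: nand_closure.base)
    then have "infinite (fst (f Y))"
      using exact pos[OF Y(1)] by (fastforce simp: P_def exact_pairs_def)
    \<comment> \<open>The set representing \<open>u\<close> for this \<open>Y\<close> is infinite,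
      so some \<open>F n\<close> contains it. Yet it is almost disjoint from the preimage of a
      clopen neighbourhood of the cluster point \<open>x n\<close>.\<close>
    then obtain n where n: "fst (f Y) \<in> F n"
      using cover \<open>f Y \<in> P\<close> by blast
    obtain c where c: "cantor_clopen c" "C n \<subseteq> c" "finite (fst (f Y) \<inter> cantor_seq -` c)"
      using avoid[OF Y(1), of "C n"] Y(2) by blast
    have "x n \<in> c"
      using C_x(2) c(2) by blast
    then obtain m where "{y. \<forall>i<m. y i = x n i} \<subseteq> c"
      by (rule cantor_clopen_cylinder_subset[OF c(1)])
    then have "fst (f Y) \<inter> cantor_seq -` {y. \<forall>i<m. y i = x n i} \<subseteq> fst (f Y) \<inter> cantor_seq -` c"
      by blast
    then show False
      using x[OF n] c(3) finite_subset by blast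
  qed
  then show ?thesis
    using \<mu> by blast
qed

end
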